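(* Let $A\in\mathbb{R}^{m\times n}$, $b\in\mathbb{R}^m$ and $0\le\delta<\|b\|_\infty$, and consider the problem $$(\mathrm{P}_\delta)\qquad \min_{x\in\mathbb{R}^n}\|x\|_1\quad\text{s.t.}\quad\|Ax-b\|_\infty\le\delta.$$ Then Algorithm $\ell_1$-HOUDINI (described in the context), applied to $(A,b,\delta)$, terminates after a finite number of iterations and returns an optimal solution of (P$_\delta$).
   Context: Notation: $a_i^\top$ is the $i$-th row and $A_j$ the $j$-th column of $A$; $A^I$ (resp. $A_J$) is the submatrix of rows in $I$ (resp. columns in $J$), $A_J^\top=(A_J)^\top$; $v_I$ is the subvector of $v$ indexed by $I$; complements of subsets of $\{1,\dots,m\}$ or $\{1,\dots,n\}$ are denoted by a superscript $c$; $\odot$ is the componentwise product; $\mathbf{1}$ is the all-ones vector; $\operatorname{sign}$ is the usual sign function (with $\operatorname{sign}(0)=0$), applied componentwise; vector inequalities are componentwise. Algorithm $\ell_1$-HOUDINI. Input: $A\in\mathbb{R}^{m\times n}$, $b\in\mathbb{R}^m$, $0\le\delta<\|b\|_\infty$. Initialization: $\delta^0=\|b\|_\infty$, $x^0=0$, $I_P=\{i:|b_i|=\delta^0\}$, $J_P=\emptyset$, $k=0$. Repeat the following iteration until $\delta^k=\delta$: 1. (Dual update) Let $y^{k+1}$ be a solution of the linear program $\min_{y\in\mathbb{R}^m}-\operatorname{sign}(Ax^k-b)^\top y$ subject to $-A_{J_P}^\top y=\operatorname{sign}(x^k_{J_P})$, $\ -\mathbf{1}\le -A_{J_P^c}^\top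 y\le\mathbf{1}$, $\ -\operatorname{sign}(Ax^k-b)\odot y\le0$, $\ y_{I_P^c}=0$. Set $I_D=\{i:y_i^{k+1}\ne0\}$, $J_D=\{j:|A_j^\top y^{k+1}|=1\}$. 2. (Primal update) Let $(x^{k+1},t^{k+1})$ be a solution of the linear program $\max_{(x,t)\in\mathbb{R}^n\times\mathbb{R}}t$ subject to $A^{I_D}x-b_{I_D}=(\delta^k-t)\operatorname{sign}(y^{k+1}_{I_D})$, $\ (t-\delta^k)\mathbf{1}\le A^{I_D^c}x-b_{I_D^c}\le(\delta^k-t)\mathbf{1}$, $\ (A^\top y^{k+1})\odot x\le0$, $\ x_{J_D^c}=0$, $\ t\le\delta^k-\delta$. Set $\delta^{k+1}=\delta^k-t^{k+1}$, $I_P=\{i:|a_i^\top x^{k+1}-b_i|=\delta^{k+1}\}$, $J_P=\{j:x_j^{k+1}\ne0\}$. 3. Increase $k$ by $1$. Output: the last computed primal iterate $x^k$ (for the final value of $k$, i.e. with $\delta^k=\delta$).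
   Formalization: That the linear programs are solvable, so the algorithm reaches δ^k = δ, is proved only when (P_δ) is feasible; otherwise no optimal solution exists and the claim fails (A = 0, b = 1, δ = 0: the first dual program is unbounded). *)

theory Defs
  imports "HOL-Analysis.Analysis"
begin

definition l1_norm :: "real ^ 'n \<Rightarrow> real" where
  "l1_norm x = (\<Sum>j\<in>UNIV. \<bar>x $ j\<bar>)"

text \<open>The componentwise sign; the library's \<^term>\<open>sgn v\<close> on vectors is the
  normalised vector \<open>v / norm v\<close>.\<close>

definition vsign :: "real ^ 'k \<Rightarrow> real ^ 'k" where
  "vsign v = (\<chi> i. sgn (v $ i))"

definition P_feasible :: "real ^ 'n ^ 'm \<Rightarrow> real ^ 'm \<Rightarrow> real \<Rightarrow> real ^ 'n \<Rightarrow> bool" where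
  "P_feasible A b \<delta> x \<longleftrightarrow> infnorm (A *v x - b) \<le> \<delta>"

definition P_optimal :: "real ^ 'n ^ 'm \<Rightarrow> real ^ 'm \<Rightarrow> real \<Rightarrow> real ^ 'n \<Rightarrow> bool" where
  "P_optimal A b \<delta> x \<longleftrightarrow> is_arg_min l1_norm (P_feasible A b \<delta>) x"

text \<open>A state is \<open>(x\<^sup>k, \<delta>\<^sup>k, I\<^sub>P, J\<^sub>P)\<close>. The linear programs may have several
  solutions, of which the algorithm picks an arbitrary one, so the iteration is a
  relation between states.\<close>

type_synonym ('m, 'n) houdini_state = "(real ^ 'n) \<times> real \<times> 'm set \<times> 'n set"

definition houdini_init :: "real ^ 'm \<Rightarrow> ('m, 'n::finite) houdini_state" where
  "houdini_init b = (0, infnorm b, {i. \<bar>b $ i\<bar> = infnorm b}, {})"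

definition dual_feasible ::
  "real ^ 'n ^ 'm \<Rightarrow> real ^ 'm \<Rightarrow> ('m, 'n) houdini_state \<Rightarrow> real ^ 'm \<Rightarrow> bool" where
  "dual_feasible A b = (\<lambda>(x, d, IP, JP) y.
     (\<forall>j\<in>JP. - (transpose A *v y) $ j = sgn (x $ j)) \<and>
     (\<forall>j\<in>-JP. -1 \<le> - (transpose A *v y) $ j \<and> - (transpose A *v y) $ j \<le> 1) \<and>
     (\<forall>i. - (vsign (A *v x - b) $ i) * y $ i \<le> 0) \<and>
     (\<forall>i\<in>-IP. y $ i = 0))"

definition dual_solution ::
  "real ^ 'n ^ 'm \<Rightarrow> real ^ 'm \<Rightarrow> ('m, 'n) houdini_state \<Rightarrow> real ^ 'm \<Rightarrow> bool" where
  "dual_solution A b = (\<lambda>(x, d, IP, JP).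
     is_arg_min (\<lambda>y. - vsign (A *v x - b) \<bullet> y) (dual_feasible A b (x, d, IP, JP)))"

text \<open>In the next two definitions \<open>d\<close> is \<open>\<delta>\<^sup>k\<close> and \<open>y\<close> is \<open>y\<^sup>k\<^sup>+\<^sup>1\<close>; the index
  sets \<open>I\<^sub>D\<close> and \<open>J\<^sub>D\<close> are functions of \<open>y\<close>.\<close>

definition primal_feasible ::
  "real ^ 'n ^ 'm \<Rightarrow> real ^ 'm \<Rightarrow> real \<Rightarrow> real \<Rightarrow> real ^ 'm \<Rightarrow> (real ^ 'n) \<times> real \<Rightarrow> bool" where
  "primal_feasible A b \<delta> d y = (\<lambda>(x, t).
     let ID = {i. y $ i \<noteq> 0};
         JD = {j. \<bar>(transpose A *v y) $ j\<bar> = 1}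
     in (\<forall>i\<in>ID. (A *v x - b) $ i = (d - t) * sgn (y $ i)) \<and>
        (\<forall>i\<in>-ID. t - d \<le> (A *v x - b) $ i \<and> (A *v x - b) $ i \<le> d - t) \<and>
        (\<forall>j. (transpose A *v y) $ j * x $ j \<le> 0) \<and>
        (\<forall>j\<in>-JD. x $ j = 0) \<and>
        t \<le> d - \<delta>)"

definition primal_solution ::
  "real ^ 'n ^ 'm \<Rightarrow> real ^ 'm \<Rightarrow> real \<Rightarrow> real \<Rightarrow> real ^ 'm \<Rightarrow> (real ^ 'n) \<times> real \<Rightarrow> bool" where
  "primal_solution A b \<delta> d y = is_arg_max snd (primal_feasible A b \<delta> d y)"

inductive houdini_step ::
  "real ^ 'n ^ 'm \<Rightarrow> real ^ 'm \<Rightarrow> real \<Rightarrow>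
   ('m, 'n) houdini_state \<Rightarrow> ('m, 'n) houdini_state \<Rightarrow> bool"
  for A b \<delta> where
  "\<lbrakk> d \<noteq> \<delta>;
     dual_solution A b (x, d, IP, JP) y;
     primal_solution A b \<delta> d y (x', t') \<rbrakk>
   \<Longrightarrow> houdini_step A b \<delta> (x, d, IP, JP)
         (x', d - t', {i. \<bar>(A *v x' - b) $ i\<bar> = d - t'}, {j. x' $ j \<noteq> 0})"

definition houdini_reachable ::
  "real ^ 'n ^ 'm \<Rightarrow> real ^ 'm \<Rightarrow> real \<Rightarrow> ('m, 'n) houdini_state \<Rightarrow> bool" where
  "houdini_reachable A b \<delta> s \<longleftrightarrow> (houdini_step A b \<delta>)\<^sup>*\<^sup>* (houdini_init b) s"

end

theory Submission
  imports Defs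
begin

text \<open>
  Write \<open>P d\<close> for the problem of minimising \<open>l1_norm x\<close> subject to \<open>\<bar>(A *v x - b) $ i\<bar> \<le> d\<close> for
  all \<open>i\<close>. By linear programming duality, a feasible \<open>x\<close> solves \<open>P d\<close> if and only if some
  \<open>y\<close> with \<open>\<bar>(y v* A) $ j\<bar> \<le> 1\<close> satisfies complementary slackness: \<open>y v* A\<close> equals \<open>- sgn x\<close> on the support
  of \<open>x\<close>, and the residual equals \<open>d * sgn y\<close> on the support of \<open>y\<close>. Such a \<open>y\<close> is called a
  certificate of \<open>x\<close> at level \<open>d\<close> below (\<open>certifies\<close>). The whole algorithm can be read in these
  terms. The dual linear program fixes \<open>(x, d)\<close> and looks for the certificate of largest
  \<open>\<ell>\<^sub>1\<close>-norm (\<open>dual_feasible_iff\<close>, \<open>l1_norm_certificate\<close>); the primal one fixes the certificate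
  \<open>y\<close> and looks for the smallest level in \<open>{\<delta>..}\<close> at which \<open>y\<close> still certifies some point
  (\<open>primal_feasible_iff\<close>). Hence every iterate is certified, and so it is optimal at its own
  level; at level \<open>\<delta>\<close> this is optimality for the given problem.

  If \<open>P \<delta>\<close> is feasible, both programs have solutions because the optimum can be sought in a compact
  set. Weak duality (\<open>certifies_gap\<close>) gives \<open>l1_norm x + (d - \<delta>) * l1_norm y \<le> l1_norm x'\<close>
  for every feasible point \<open>x'\<close> of \<open>P \<delta>\<close>, which bounds the certificates as long as \<open>d > \<delta>\<close>; the points certified by a
  fixed \<open>y\<close> are bounded because their \<open>\<ell>\<^sub>1\<close>-norm is \<open>- d * l1_norm y - y \<bullet> b\<close>.

  Termination has two ingredients. First, the level strictly decreases: if \<open>y\<close> has the largest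
  norm among the certificates of \<open>x\<close>, then by Farkas' lemma there is a \<open>z\<close> such that along \<open>- z\<close>
  all active residuals shrink at unit rate at least (exactly, on the support of \<open>y\<close>) without
  destroying complementary slackness, so \<open>y\<close> certifies \<open>x - \<epsilon> z\<close> at level \<open>d - \<epsilon>\<close> for small
  \<open>\<epsilon> > 0\<close> (\<open>largest_certificate_descends\<close>). Second, what a \<open>y\<close> can certify depends only on the
  signs of \<open>y\<close> and on the positions where \<open>y v* A\<close> is \<open>1\<close> or \<open>- 1\<close> (\<open>certifies_pattern\<close>). As
  there are finitely many such patterns and the new level is determined by the pattern, an
  infinite run would have to repeat a level.
\<close>

section \<open>Optimality certificates\<close>

definition certifies ::
  "real ^ 'n ^ 'm \<Rightarrow> real ^ 'm \<Rightarrow> real \<Rightarrow> real ^ 'n \<Rightarrow> real ^ 'm \<Rightarrow> bool" where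
  "certifies A b d x y \<longleftrightarrow>
     (\<forall>i. \<bar>(A *v x - b) $ i\<bar> \<le> d) \<and>
     (\<forall>j. \<bar>(y v* A) $ j\<bar> \<le> 1) \<and>
     (\<forall>j. x $ j \<noteq> 0 \<longrightarrow> (y v* A) $ j = - sgn (x $ j)) \<and>
     (\<forall>i. y $ i \<noteq> 0 \<longrightarrow> (A *v x - b) $ i = d * sgn (y $ i))"

lemma certifiesD:
  assumes "certifies A b d x y"
  shows "\<bar>(A *v x - b) $ i\<bar> \<le> d"
    and "\<bar>(y v* A) $ j\<bar> \<le> 1"
    and "x $ j \<noteq> 0 \<Longrightarrow> (y v* A) $ j = - sgn (x $ j)"
    and "y $ i \<noteq> 0 \<Longrightarrow> (A *v x - b) $ i = d * sgn (y $ i)"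
  using assms unfolding certifies_def by blast+

lemma P_feasible_iff: "P_feasible A b d x \<longleftrightarrow> (\<forall>i. \<bar>(A *v x - b) $ i\<bar> \<le> d)"
proof -
  have "infnorm v \<le> d \<longleftrightarrow> (\<forall>i. \<bar>v $ i\<bar> \<le> d)" for v :: "real ^ 'm"
  proof
    show "\<forall>i. \<bar>v $ i\<bar> \<le> d" if "infnorm v \<le> d"
      using that component_le_infnorm_cart order_trans by blast
    show "infnorm v \<le> d" if "\<forall>i. \<bar>v $ i\<bar> \<le> d"
      unfolding infnorm_cart using that by (intro cSup_least) auto
  qed
  thus ?thesis
    unfolding P_feasible_def by blast
qed

lemma l1_norm_nonneg: "0 \<le> l1_norm x"
  by (simp add: l1_norm_def sum_nonneg)

lemma norm_le_l1_norm: "norm x \<le> l1_norm x"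
  by (simp add: l1_norm_def norm_le_l1_cart)

lemma certifies_l1_norm:
  assumes "certifies A b d x y"
  shows "l1_norm x = - d * l1_norm y - y \<bullet> b"
proof -
  have "(y v* A) \<bullet> x = - l1_norm x"
    unfolding inner_vec_def l1_norm_def sum_negf[symmetric]
  proof (rule sum.cong[OF refl])
    show "(y v* A) $ j \<bullet> x $ j = - \<bar>x $ j\<bar>" for j
      using certifiesD(3)[OF assms, of j] by (cases "x $ j = 0") (auto simp: sgn_if)
  qed
  moreover have "y \<bullet> (A *v x - b) = d * l1_norm y"
    unfolding inner_vec_def l1_norm_def sum_distrib_left
  proof (rule sum.cong[OF refl])
    show "y $ i \<bullet> (A *v x - b) $ i = d * \<bar>y $ i\<bar>" for i
      using certifiesD(4)[OF assms, of i] by (cases "y $ i = 0") (auto simp: sgn_if)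
  qed
  ultimately show ?thesis
    by (simp add: dot_lmul_matrix inner_diff_right)
qed

text \<open>Weak duality for two levels at once. With \<open>e = d\<close> it says that certified points are optimal;
  with \<open>e < d\<close> it bounds the certificates.\<close>

lemma certifies_gap:
  assumes cert: "certifies A b d x y" and feas: "\<And>i. \<bar>(A *v x' - b) $ i\<bar> \<le> e"
  shows "l1_norm x + (d - e) * l1_norm y \<le> l1_norm x'"
proof -
  have "- ((y v* A) \<bullet> x') \<le> l1_norm x'"
    unfolding inner_vec_def l1_norm_def sum_negf[symmetric]
  proof (rule sum_mono)
    fix j
    have "\<bar>(y v* A) $ j * x' $ j\<bar> \<le> \<bar>x' $ j\<bar>"
      using mult_right_mono[OF certifiesD(2)[OF cert, of j], of "\<bar>x' $ j\<bar>"] by (simp add: abs_mult)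
    thus "- ((y v* A) $ j \<bullet> x' $ j) \<le> \<bar>x' $ j\<bar>"
      by simp
  qed
  moreover have "y \<bullet> (A *v x' - b) \<le> e * l1_norm y"
    unfolding inner_vec_def l1_norm_def sum_distrib_left
  proof (rule sum_mono)
    fix i
    have "\<bar>y $ i * (A *v x' - b) $ i\<bar> \<le> e * \<bar>y $ i\<bar>"
      using mult_left_mono[OF feas[of i], of "\<bar>y $ i\<bar>"] by (simp add: abs_mult mult.commute)
    thus "y $ i \<bullet> (A *v x' - b) $ i \<le> e * \<bar>y $ i\<bar>"
      by simp
  qed
  ultimately show ?thesis
    using certifies_l1_norm[OF cert] by (simp add: dot_lmul_matrix inner_diff_right algebra_simps)
qed

lemma certifies_imp_P_optimal:
  assumes "certifies A b d x y"
  shows "P_optimal A b d x"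
  using certifies_gap[OF assms, where e = d] certifiesD(1)[OF assms]
  by (force simp: P_optimal_def is_arg_min_def P_feasible_iff not_less)

text \<open>The \<open>\<ell>\<^sub>1\<close>-norm is linear on the certificates of a fixed point, since their signs are
  prescribed by the residual. This is why the objective of the dual program measures it.\<close>

lemma l1_norm_certificate:
  assumes "certifies A b d x y" "0 < d"
  shows "vsign (A *v x - b) \<bullet> y = l1_norm y"
  unfolding inner_vec_def l1_norm_def
proof (rule sum.cong[OF refl])
  show "vsign (A *v x - b) $ i \<bullet> y $ i = \<bar>y $ i\<bar>" for i
    using certifiesD(4)[OF assms(1), of i] assms(2)
    by (cases "y $ i = 0") (auto simp: vsign_def sgn_mult sgn_if)
qed

text \<open>Where \<open>\<bar>(y v* A) $ j\<bar> < 1\<close>, a certified point has coordinate \<open>0\<close>, and only the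
  values \<open>1\<close> and \<open>- 1\<close> tie \<open>(y v* A) $ j\<close> to a sign of \<open>x $ j\<close>; the residual sees \<open>y $ i\<close> only
  through its sign.\<close>

lemma certifies_pattern:
  assumes cert: "certifies A b d x y"
    and bound: "\<And>j. \<bar>(y' v* A) $ j\<bar> \<le> 1"
    and sgn: "\<And>i. sgn (y' $ i) = sgn (y $ i)"
    and tight: "\<And>j. (y' v* A) $ j = 1 \<longleftrightarrow> (y v* A) $ j = 1"
      "\<And>j. (y' v* A) $ j = - 1 \<longleftrightarrow> (y v* A) $ j = - 1"
  shows "certifies A b d x y'"
proof -
  have "(y' v* A) $ j = - sgn (x $ j)" if "x $ j \<noteq> 0" for j
    using certifiesD(3)[OF cert that] that tight[of j] by (auto simp: sgn_if split: if_splits)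
  moreover have "(A *v x - b) $ i = d * sgn (y' $ i)" if "y' $ i \<noteq> 0" for i
    using certifiesD(4)[OF cert, of i] that sgn[of i] by (metis sgn_eq_0_iff)
  ultimately show ?thesis
    using certifiesD(1)[OF cert] bound unfolding certifies_def by blast
qed

section \<open>The linear programs in terms of certificates\<close>

text \<open>The dual program prescribes the sign of \<open>y\<close> by the sign of the residual; the residual of an
  active constraint is \<open>d\<close> times its sign, and \<open>d > 0\<close> lets one recover this from the sign of
  \<open>y\<close>.\<close>

lemma dual_feasible_iff:
  assumes "0 < d" "\<And>i. \<bar>(A *v x - b) $ i\<bar> \<le> d"
  shows "dual_feasible A b (x, d, {i. \<bar>(A *v x - b) $ i\<bar> = d}, {j. x $ j \<noteq> 0}) y
         \<longleftrightarrow> certifies A b d x y"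
proof -
  define r where "r = A *v x - b"
  have row: "(- sgn (r $ i) * y $ i \<le> 0 \<and> (\<bar>r $ i\<bar> \<noteq> d \<longrightarrow> y $ i = 0)) \<longleftrightarrow>
             (y $ i \<noteq> 0 \<longrightarrow> r $ i = d * sgn (y $ i))" for i
    using assms(1) by (auto simp: sgn_if abs_if mult_less_0_iff split: if_splits)
  have col: "((x $ j \<noteq> 0 \<longrightarrow> - (y v* A) $ j = sgn (x $ j)) \<and>
              (x $ j = 0 \<longrightarrow> - 1 \<le> - (y v* A) $ j \<and> - (y v* A) $ j \<le> 1)) \<longleftrightarrow>
             (\<bar>(y v* A) $ j\<bar> \<le> 1 \<and> (x $ j \<noteq> 0 \<longrightarrow> (y v* A) $ j = - sgn (x $ j)))" for j
    by (auto simp: sgn_if)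
  have "dual_feasible A b (x, d, {i. \<bar>r $ i\<bar> = d}, {j. x $ j \<noteq> 0}) y \<longleftrightarrow>
    (\<forall>j. (x $ j \<noteq> 0 \<longrightarrow> - (y v* A) $ j = sgn (x $ j)) \<and>
         (x $ j = 0 \<longrightarrow> - 1 \<le> - (y v* A) $ j \<and> - (y v* A) $ j \<le> 1)) \<and>
    (\<forall>i. - sgn (r $ i) * y $ i \<le> 0 \<and> (\<bar>r $ i\<bar> \<noteq> d \<longrightarrow> y $ i = 0))"
    unfolding dual_feasible_def prod.case vsign_def r_def[symmetric] by auto
  also have "\<dots> \<longleftrightarrow> certifies A b d x y"
    unfolding row col certifies_def r_def[symmetric] using assms(2)[folded r_def] by blast
  finally show ?thesis
    unfolding r_def .
qed

lemma primal_feasible_iff: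
  assumes "0 \<le> \<delta>" and bound: "\<And>j. \<bar>(y v* A) $ j\<bar> \<le> 1"
  shows "primal_feasible A b \<delta> d y (x, t) \<longleftrightarrow> \<delta> \<le> d - t \<and> certifies A b (d - t) x y"
proof (cases "\<delta> \<le> d - t")
  case True
  define r where "r = A *v x - b"
  have row: "((y $ i \<noteq> 0 \<longrightarrow> r $ i = (d - t) * sgn (y $ i)) \<and>
              (y $ i = 0 \<longrightarrow> t - d \<le> r $ i \<and> r $ i \<le> d - t)) \<longleftrightarrow>
             (\<bar>r $ i\<bar> \<le> d - t \<and> (y $ i \<noteq> 0 \<longrightarrow> r $ i = (d - t) * sgn (y $ i)))" for i
    using True assms(1) by (auto simp: sgn_if)
  have col: "((y v* A) $ j * x $ j \<le> 0 \<and> (\<bar>(y v* A) $ j\<bar> \<noteq> 1 \<longrightarrow> x $ j = 0)) \<longleftrightarrow>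
             (x $ j \<noteq> 0 \<longrightarrow> (y v* A) $ j = - sgn (x $ j))" for j
    by (auto simp: sgn_if abs_if mult_le_0_iff split: if_splits)
  have "primal_feasible A b \<delta> d y (x, t) \<longleftrightarrow>
    (\<forall>i. (y $ i \<noteq> 0 \<longrightarrow> r $ i = (d - t) * sgn (y $ i)) \<and>
         (y $ i = 0 \<longrightarrow> t - d \<le> r $ i \<and> r $ i \<le> d - t)) \<and>
    (\<forall>j. (y v* A) $ j * x $ j \<le> 0 \<and> (\<bar>(y v* A) $ j\<bar> \<noteq> 1 \<longrightarrow> x $ j = 0))"
    using True unfolding primal_feasible_def prod.case Let_def r_def[symmetric] by auto
  also have "\<dots> \<longleftrightarrow> certifies A b (d - t) x y"
    unfolding row col certifies_def r_def[symmetric] using bound by blast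
  finally show ?thesis
    using True by blast
next
  case False
  thus ?thesis
    unfolding primal_feasible_def Let_def by auto
qed

section \<open>Strict decrease of the level\<close>

text \<open>A finitely generated cone is closed, so a point outside it is strictly separated from it by a
  hyperplane, whose normal vector violates the assumption.\<close>

lemma farkas_cone:
  fixes c :: "'a :: euclidean_space"
  assumes "finite S" and dual: "\<And>w. (\<And>g. g \<in> S \<Longrightarrow> g \<bullet> w \<le> 0) \<Longrightarrow> c \<bullet> w \<le> 0"
  shows "c \<in> convex_cone hull S"
proof (rule ccontr)
  let ?K = "convex_cone hull S"
  assume "c \<notin> ?K"
  then obtain a \<beta> where a: "a \<bullet> c < \<beta>" "\<And>g. g \<in> ?K \<Longrightarrow> \<beta> < a \<bullet> g"
    using separating_hyperplane_closed_point[of ?K c] closed_convex_cone_hull[OF \<open>finite S\<close>]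
      convex_convex_cone_hull by blast
  have "\<beta> < 0"
    using a(2)[OF convex_cone_hull_contains_0] by simp
  have "g \<bullet> (- a) \<le> 0" if "g \<in> S" for g
  proof (rule ccontr)
    assume "\<not> g \<bullet> (- a) \<le> 0"
    hence neg: "a \<bullet> g < 0"
      by (simp add: inner_commute)
    \<comment> \<open>The multiple of \<open>g\<close> on which the separating functional takes the forbidden value \<open>\<beta>\<close>\<close>
    have "(\<beta> / (a \<bullet> g)) *\<^sub>R g \<in> ?K"
      using neg \<open>\<beta> < 0\<close> that by (intro convex_cone_hull_mul hull_inc) (auto simp: divide_nonpos_neg)
    from a(2)[OF this] neg show False
      by simp
  qed
  from dual[OF this] a(1) \<open>\<beta> < 0\<close> show False
    by (simp add: inner_commute)
qed

lemma affine_tendsto_at_right: "((\<lambda>\<epsilon>. a + \<epsilon> * h) \<longlongrightarrow> a) (at_right (0 :: real))" for a h :: real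
  by (rule tendsto_eq_intros refl | simp)+

lemma eventually_sgn_affine:
  fixes a h :: real
  assumes "a \<noteq> 0"
  shows "\<forall>\<^sub>F \<epsilon> in at_right 0. sgn (a + \<epsilon> * h) = sgn a"
proof (cases "0 < a")
  case True
  from order_tendstoD(1)[OF affine_tendsto_at_right this, of h] show ?thesis
    by eventually_elim (use True in simp)
next
  case False
  hence "a < 0"
    using assms by simp
  from order_tendstoD(2)[OF affine_tendsto_at_right this, of h] show ?thesis
    by eventually_elim (use \<open>a < 0\<close> in simp)
qed

text \<open>The only first-order condition for staying in \<open>[-d, d]\<close> while \<open>d\<close> shrinks at rate \<open>k\<close> is at the
  end points, where the motion has to lead inwards fast enough.\<close>

lemma eventually_abs_affine_le:
  fixes a h d k :: real
  assumes "0 < d" "\<bar>a\<bar> \<le> d" and "\<bar>a\<bar> = d \<Longrightarrow> a * h \<le> - (d * k)"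
  shows "\<forall>\<^sub>F \<epsilon> in at_right 0. \<bar>a + \<epsilon> * h\<bar> \<le> d - \<epsilon> * k"
proof (cases "\<bar>a\<bar> = d")
  case True
  hence "a \<noteq> 0"
    using assms(1) by auto
  have slope: "sgn a * h \<le> - k"
    using assms(1) assms(3)[OF True] True
    by (auto simp: sgn_if abs_if split: if_splits) (metis minus_mult_right mult_le_cancel_left_pos)
  from eventually_sgn_affine[OF \<open>a \<noteq> 0\<close>, of h] eventually_at_right_less show ?thesis
  proof eventually_elim
    case (elim \<epsilon>)
    have "\<bar>a + \<epsilon> * h\<bar> = sgn a * (a + \<epsilon> * h)"
      using elim(1) by (metis abs_sgn mult.commute)
    also have "\<dots> = d + \<epsilon> * (sgn a * h)"
      using True by (simp add: algebra_simps abs_sgn)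
    also have "\<dots> \<le> d - \<epsilon> * k"
      using mult_left_mono[OF slope, of \<epsilon>] elim(2) by simp
    finally show ?case .
  qed
next
  case False
  have "((\<lambda>\<epsilon>. \<bar>a + \<epsilon> * h\<bar> + \<epsilon> * k) \<longlongrightarrow> \<bar>a\<bar> + 0 * k) (at_right 0)"
    by (intro tendsto_intros affine_tendsto_at_right)
  hence "\<forall>\<^sub>F \<epsilon> in at_right 0. \<bar>a + \<epsilon> * h\<bar> + \<epsilon> * k < d"
    using False assms(2) by (intro order_tendstoD(2)) auto
  thus ?thesis
    by eventually_elim simp
qed

text \<open>The multipliers that Farkas' lemma produces when no direction \<open>w\<close> increases the norm of the
  certificate \<open>y\<close> to first order: \<open>z\<close> collects those of the constraints on \<open>y v* A\<close>, and those of
  the sign constraints on \<open>y\<close> are absorbed in the last inequality.\<close>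

lemma largest_certificate_multipliers:
  fixes A :: "real ^ 'n ^ 'm"
  assumes cert: "certifies A b d x y" and "0 < d"
    and largest: "\<And>y'. certifies A b d x y' \<Longrightarrow> l1_norm y' \<le> l1_norm y"
  obtains z where
    "\<And>j. x $ j = 0 \<Longrightarrow> \<bar>z $ j\<bar> \<le> (y v* A) $ j * z $ j"
    "\<And>i. y $ i \<noteq> 0 \<Longrightarrow> (A *v z) $ i = sgn (y $ i)"
    "\<And>i. \<bar>(A *v x - b) $ i\<bar> = d \<Longrightarrow> d \<le> (A *v x - b) $ i * (A *v z) $ i"
proof -
  define r where "r = A *v x - b"
  note cD = certifiesD[OF cert, folded r_def]
  \<comment> \<open>The right-hand sides \<open>c\<close> for which a \<open>z\<close> exists; the goal is the case \<open>c = vsign r\<close>. As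
    \<open>\<bar>(y v* A) $ j\<bar> \<le> 1\<close>, the first condition says that \<open>z $ j\<close> vanishes or \<open>(y v* A) $ j\<close> is its
    sign; in this form it is preserved by sums because of the triangle inequality.\<close>
  define K where "K = {c. \<exists>z. (\<forall>j. x $ j = 0 \<longrightarrow> \<bar>z $ j\<bar> \<le> (y v* A) $ j * z $ j) \<and>
      (\<forall>i. y $ i \<noteq> 0 \<longrightarrow> (A *v z) $ i = c $ i) \<and>
      (\<forall>i. \<bar>r $ i\<bar> = d \<longrightarrow> r $ i * c $ i \<le> r $ i * (A *v z) $ i)}"
  \<comment> \<open>The vectors \<open>g\<close> of the inequalities \<open>g \<bullet> w \<le> 0\<close> that describe the directions \<open>w\<close> in which \<open>y\<close>
    can move as a certificate of \<open>x\<close>; an equation is written as two inequalities.\<close>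
  define G where "G =
      (\<lambda>(s, j). s *\<^sub>R column j A) ` ({1, - 1} \<times> {j. x $ j \<noteq> 0}) \<union>
      (\<lambda>j. (y v* A) $ j *\<^sub>R column j A) ` {j. x $ j = 0 \<and> \<bar>(y v* A) $ j\<bar> = 1} \<union>
      (\<lambda>i. axis i (- (r $ i))) ` {i. \<bar>r $ i\<bar> = d \<and> y $ i = 0} \<union>
      (\<lambda>(s, i). axis i s) ` ({1, - 1} \<times> {i. \<bar>r $ i\<bar> < d})"
  have "finite G"
    unfolding G_def by simp
  have GK: "G \<subseteq> K"
  proof -
    have column: "A *v axis j s = s *\<^sub>R column j A" for j s
      by (simp add: vec_eq_iff matrix_vector_mult_def column_def axis_def if_distrib mult.commute
          cong: if_cong)
    have axis: "axis k s $ l = (if l = k then s else 0)" for k l and s :: real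
      by (simp add: axis_def)
    have "s *\<^sub>R column j A \<in> K" if "x $ j \<noteq> 0" for s j
      unfolding K_def mem_Collect_eq
      by (rule exI[of _ "axis j s"]) (use that in \<open>auto simp: column axis\<close>)
    moreover have "(y v* A) $ j *\<^sub>R column j A \<in> K" if "\<bar>(y v* A) $ j\<bar> = 1" for j
      unfolding K_def mem_Collect_eq
      by (rule exI[of _ "axis j ((y v* A) $ j)"])
         (use that in \<open>auto simp: column axis abs_if split: if_splits\<close>)
    moreover have "axis i (- (r $ i)) \<in> K" if "y $ i = 0" for i
      unfolding K_def mem_Collect_eq
      by (rule exI[of _ 0]) (use that in \<open>auto simp: axis\<close>)
    moreover have "axis i s \<in> K" if "\<bar>r $ i\<bar> < d" for i s
    proof -
      have "y $ i = 0"
        using that cD(4)[of i] \<open>0 < d\<close> by (metis abs_mult abs_of_pos abs_sgn_eq_1 less_irrefl mult_1_right)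
      thus ?thesis
        unfolding K_def mem_Collect_eq
        by (intro exI[of _ 0]) (use that in \<open>auto simp: axis\<close>)
    qed
    ultimately show ?thesis
      unfolding G_def by (auto simp del: vector_minus_component)
  qed
  have "convex_cone K"
    unfolding convex_cone_iff
  proof (intro conjI ballI allI impI)
    show "0 \<in> K"
      unfolding K_def by (auto intro!: exI[of _ 0])
  next
    fix c c' assume "c \<in> K" "c' \<in> K"
    then obtain z z' where
      z: "\<And>j. x $ j = 0 \<Longrightarrow> \<bar>z $ j\<bar> \<le> (y v* A) $ j * z $ j"
        "\<And>i. y $ i \<noteq> 0 \<Longrightarrow> (A *v z) $ i = c $ i"
        "\<And>i. \<bar>r $ i\<bar> = d \<Longrightarrow> r $ i * c $ i \<le> r $ i * (A *v z) $ i"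
      and z': "\<And>j. x $ j = 0 \<Longrightarrow> \<bar>z' $ j\<bar> \<le> (y v* A) $ j * z' $ j"
        "\<And>i. y $ i \<noteq> 0 \<Longrightarrow> (A *v z') $ i = c' $ i"
        "\<And>i. \<bar>r $ i\<bar> = d \<Longrightarrow> r $ i * c' $ i \<le> r $ i * (A *v z') $ i"
      unfolding K_def by blast
    show "c + c' \<in> K"
      unfolding K_def mem_Collect_eq
    proof (intro exI[of _ "z + z'"] conjI allI impI)
      show "\<bar>(z + z') $ j\<bar> \<le> (y v* A) $ j * (z + z') $ j" if "x $ j = 0" for j
        using z(1)[OF that] z'(1)[OF that] abs_triangle_ineq[of "z $ j" "z' $ j"]
        by (simp add: distrib_left)
      show "(A *v (z + z')) $ i = (c + c') $ i" if "y $ i \<noteq> 0" for i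
        using z(2)[OF that] z'(2)[OF that] by (simp add: matrix_vector_right_distrib)
      show "r $ i * (c + c') $ i \<le> r $ i * (A *v (z + z')) $ i" if "\<bar>r $ i\<bar> = d" for i
        using z(3)[OF that] z'(3)[OF that] by (simp add: matrix_vector_right_distrib distrib_left)
    qed
  next
    fix c and a :: real assume "c \<in> K" "0 \<le> a"
    then obtain z where
      z: "\<And>j. x $ j = 0 \<Longrightarrow> \<bar>z $ j\<bar> \<le> (y v* A) $ j * z $ j"
        "\<And>i. y $ i \<noteq> 0 \<Longrightarrow> (A *v z) $ i = c $ i"
        "\<And>i. \<bar>r $ i\<bar> = d \<Longrightarrow> r $ i * c $ i \<le> r $ i * (A *v z) $ i"
      unfolding K_def by blast
    show "a *\<^sub>R c \<in> K"
      unfolding K_def mem_Collect_eq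
    proof (intro exI[of _ "a *\<^sub>R z"] conjI allI impI)
      show "\<bar>(a *\<^sub>R z) $ j\<bar> \<le> (y v* A) $ j * (a *\<^sub>R z) $ j" if "x $ j = 0" for j
        using mult_left_mono[OF z(1)[OF that] \<open>0 \<le> a\<close>] \<open>0 \<le> a\<close>
        by (simp add: abs_mult mult.left_commute)
      show "(A *v (a *\<^sub>R z)) $ i = (a *\<^sub>R c) $ i" if "y $ i \<noteq> 0" for i
        using z(2)[OF that] by (simp add: matrix_vector_mult_scaleR)
      show "r $ i * (a *\<^sub>R c) $ i \<le> r $ i * (A *v (a *\<^sub>R z)) $ i" if "\<bar>r $ i\<bar> = d" for i
        using mult_left_mono[OF z(3)[OF that] \<open>0 \<le> a\<close>]
        by (simp add: matrix_vector_mult_scaleR mult.left_commute)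
    qed
  qed
  have "vsign r \<in> convex_cone hull G"
  proof (rule farkas_cone[OF \<open>finite G\<close>])
    \<comment> \<open>Such a \<open>w\<close> is a direction in which \<open>y\<close> remains a certificate for a while\<close>
    fix w assume w: "\<And>g. g \<in> G \<Longrightarrow> g \<bullet> w \<le> 0"
    have column: "column j A \<bullet> w = (w v* A) $ j" for j
      by (simp add: inner_vec_def column_def vector_matrix_mult_def mult.commute)
    have w_supp: "(w v* A) $ j = 0" if "x $ j \<noteq> 0" for j
    proof -
      have "s *\<^sub>R column j A \<in> G" if "s \<in> {1, - 1}" for s
        unfolding G_def using that \<open>x $ j \<noteq> 0\<close>
        by (intro UnI1 image_eqI[of _ _ "(s, j)"]) simp_all
      from w[OF this[of 1]] w[OF this[of "- 1"]] show ?thesis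
        by (simp add: column)
    qed
    have w_tight: "(y v* A) $ j * (w v* A) $ j \<le> 0" if "x $ j = 0" "\<bar>(y v* A) $ j\<bar> = 1" for j
    proof -
      have "(y v* A) $ j *\<^sub>R column j A \<in> G"
        unfolding G_def by (rule UnI1, rule UnI1, rule UnI2, rule imageI) (use that in simp)
      from w[OF this] show ?thesis
        by (simp add: column)
    qed
    have w_active: "0 \<le> r $ i * w $ i" if "\<bar>r $ i\<bar> = d" "y $ i = 0" for i
    proof -
      have "axis i (- (r $ i)) \<in> G"
        unfolding G_def by (rule UnI1, rule UnI2, rule imageI) (use that in simp)
      from w[OF this] show ?thesis
        by (simp add: inner_axis')
    qed
    have w_inactive: "w $ i = 0" if "\<bar>r $ i\<bar> < d" for i
    proof -
      have "axis i s \<in> G" if "s \<in> {1, - 1}" for s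
        unfolding G_def using that \<open>\<bar>r $ i\<bar> < d\<close>
        by (intro UnI2 image_eqI[of _ _ "(s, i)"]) simp_all
      from w[OF this[of 1]] w[OF this[of "- 1"]] show ?thesis
        by (simp add: inner_axis')
    qed
    have mult: "((y + \<epsilon> *\<^sub>R w) v* A) $ j = (y v* A) $ j + \<epsilon> * (w v* A) $ j" for \<epsilon> j
      by (simp add: vector_matrix_mult_def algebra_simps sum.distrib sum_distrib_left)
    have ev1: "\<forall>\<^sub>F \<epsilon> in at_right 0. \<forall>j. \<bar>((y + \<epsilon> *\<^sub>R w) v* A) $ j\<bar> \<le> 1"
    proof (rule eventually_all_finite)
      fix j
      have "(y v* A) $ j * (w v* A) $ j \<le> - (1 * 0)" if "\<bar>(y v* A) $ j\<bar> = 1"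
        using w_supp[of j] w_tight[of j] that by (cases "x $ j = 0") auto
      from eventually_abs_affine_le[OF _ cD(2) this]
      show "\<forall>\<^sub>F \<epsilon> in at_right 0. \<bar>((y + \<epsilon> *\<^sub>R w) v* A) $ j\<bar> \<le> 1"
        by (simp add: mult)
    qed
    have ev2: "\<forall>\<^sub>F \<epsilon> in at_right 0. \<forall>i. (y + \<epsilon> *\<^sub>R w) $ i \<noteq> 0 \<longrightarrow>
                 r $ i = d * sgn ((y + \<epsilon> *\<^sub>R w) $ i)"
    proof (rule eventually_all_finite)
      fix i
      show "\<forall>\<^sub>F \<epsilon> in at_right 0. (y + \<epsilon> *\<^sub>R w) $ i \<noteq> 0 \<longrightarrow> r $ i = d * sgn ((y + \<epsilon> *\<^sub>R w) $ i)"
      proof (cases "y $ i = 0")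
        case False
        from eventually_sgn_affine[OF this, of "w $ i"] show ?thesis
          by eventually_elim (use cD(4)[OF False] in simp)
      next
        case True
        show ?thesis
        proof (cases "\<bar>r $ i\<bar> = d")
          case False
          hence "w $ i = 0"
            using cD(1)[of i] w_inactive[of i] by simp
          thus ?thesis
            using True by simp
        next
          case active: True
          from eventually_at_right_less show ?thesis
          proof eventually_elim
            case (elim \<epsilon>)
            show ?case
              using w_active[OF active True] active True elim \<open>0 < d\<close>
              by (auto simp: sgn_if zero_le_mult_iff zero_less_mult_iff split: if_splits)
          qed
        qed
      qed
    qed
    from ev1 ev2 have "\<forall>\<^sub>F \<epsilon> in at_right 0. certifies A b d x (y + \<epsilon> *\<^sub>R w)"
    proof eventually_elim
      case (elim \<epsilon>)
      moreover have "((y + \<epsilon> *\<^sub>R w) v* A) $ j = - sgn (x $ j)" if "x $ j \<noteq> 0" for j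
        unfolding mult using cD(3)[OF that] w_supp[OF that] by simp
      ultimately show ?case
        using cD(1) unfolding certifies_def r_def by blast
    qed
    with eventually_at_right_less
    have "\<forall>\<^sub>F \<epsilon> in at_right (0 :: real). 0 < \<epsilon> \<and> certifies A b d x (y + \<epsilon> *\<^sub>R w)"
      by (rule eventually_conj)
    from eventually_happens[OF this] obtain \<epsilon> where
      \<epsilon>: "0 < \<epsilon>" "certifies A b d x (y + \<epsilon> *\<^sub>R w)"
      by auto
    have "vsign r \<bullet> (y + \<epsilon> *\<^sub>R w) \<le> vsign r \<bullet> y"
      using largest[OF \<epsilon>(2)] l1_norm_certificate[OF \<epsilon>(2) \<open>0 < d\<close>] l1_norm_certificate[OF cert \<open>0 < d\<close>]
      by (simp add: r_def)
    thus "vsign r \<bullet> w \<le> 0"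
      using \<epsilon>(1) by (simp add: inner_add_right mult_le_0_iff)
  qed
  also have "convex_cone hull G \<subseteq> K"
    using GK \<open>convex_cone K\<close> by (rule hull_minimal)
  finally obtain z where z: "\<And>j. x $ j = 0 \<Longrightarrow> \<bar>z $ j\<bar> \<le> (y v* A) $ j * z $ j"
      "\<And>i. y $ i \<noteq> 0 \<Longrightarrow> (A *v z) $ i = sgn (r $ i)"
      "\<And>i. \<bar>r $ i\<bar> = d \<Longrightarrow> r $ i * sgn (r $ i) \<le> r $ i * (A *v z) $ i"
    unfolding K_def vsign_def by auto
  show thesis
  proof (rule that[of z])
    show "\<bar>z $ j\<bar> \<le> (y v* A) $ j * z $ j" if "x $ j = 0" for j
      using z(1)[OF that] .
    show "(A *v z) $ i = sgn (y $ i)" if "y $ i \<noteq> 0" for i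
      using z(2)[OF that] cD(4)[OF that] \<open>0 < d\<close> by (simp add: sgn_mult)
    show "d \<le> (A *v x - b) $ i * (A *v z) $ i" if "\<bar>(A *v x - b) $ i\<bar> = d" for i
      using z(3)[of i] that unfolding r_def by (simp add: abs_sgn)
  qed
qed

text \<open>Moving along \<open>- z\<close> lowers every active residual at least as fast as the level, and the
  residuals on the support of \<open>y\<close> exactly as fast, as complementary slackness demands. Coordinates
  that enter the support of \<open>x\<close> do so with the sign that \<open>y v* A\<close> prescribes.\<close>

lemma largest_certificate_descends:
  assumes cert: "certifies A b d x y" and "0 < d"
    and largest: "\<And>y'. certifies A b d x y' \<Longrightarrow> l1_norm y' \<le> l1_norm y"
  shows "\<exists>z. \<forall>\<^sub>F \<epsilon> in at_right 0. certifies A b (d - \<epsilon>) (x - \<epsilon> *\<^sub>R z) y"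
proof -
  obtain z where
    z: "\<And>j. x $ j = 0 \<Longrightarrow> \<bar>z $ j\<bar> \<le> (y v* A) $ j * z $ j"
      "\<And>i. y $ i \<noteq> 0 \<Longrightarrow> (A *v z) $ i = sgn (y $ i)"
      "\<And>i. \<bar>(A *v x - b) $ i\<bar> = d \<Longrightarrow> d \<le> (A *v x - b) $ i * (A *v z) $ i"
    using largest_certificate_multipliers[OF assms] by metis
  note cD = certifiesD[OF cert]
  have residual: "(A *v (x - \<epsilon> *\<^sub>R z) - b) $ i = (A *v x - b) $ i + \<epsilon> * (- (A *v z) $ i)" for \<epsilon> i
    by (simp add: matrix_vector_mult_diff_distrib matrix_vector_mult_scaleR)
  have ev1: "\<forall>\<^sub>F \<epsilon> in at_right 0. \<forall>i. \<bar>(A *v (x - \<epsilon> *\<^sub>R z) - b) $ i\<bar> \<le> d - \<epsilon>"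
  proof (rule eventually_all_finite)
    fix i
    have "(A *v x - b) $ i * (- (A *v z) $ i) \<le> - (d * 1)" if "\<bar>(A *v x - b) $ i\<bar> = d"
      using z(3)[OF that] by simp
    from eventually_abs_affine_le[OF \<open>0 < d\<close> cD(1) this]
    show "\<forall>\<^sub>F \<epsilon> in at_right 0. \<bar>(A *v (x - \<epsilon> *\<^sub>R z) - b) $ i\<bar> \<le> d - \<epsilon>"
      unfolding residual by simp
  qed
  have ev2: "\<forall>\<^sub>F \<epsilon> in at_right 0. \<forall>j. (x - \<epsilon> *\<^sub>R z) $ j \<noteq> 0 \<longrightarrow>
               (y v* A) $ j = - sgn ((x - \<epsilon> *\<^sub>R z) $ j)"
  proof (rule eventually_all_finite)
    fix j
    show "\<forall>\<^sub>F \<epsilon> in at_right 0. (x - \<epsilon> *\<^sub>R z) $ j \<noteq> 0 \<longrightarrow> (y v* A) $ j = - sgn ((x - \<epsilon> *\<^sub>R z) $ j)"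
    proof (cases "x $ j = 0")
      case False
      from eventually_sgn_affine[OF this, of "- z $ j"] show ?thesis
        by eventually_elim (use cD(3)[OF False] in simp)
    next
      case True
      have "(y v* A) $ j = sgn (z $ j)" if "z $ j \<noteq> 0"
      proof -
        consider "0 < z $ j" | "z $ j < 0"
          using \<open>z $ j \<noteq> 0\<close> by linarith
        thus ?thesis
        proof cases
          case 1
          hence "1 * z $ j \<le> (y v* A) $ j * z $ j"
            using z(1)[OF True] by simp
          thus ?thesis
            using 1 cD(2)[of j] by (simp only: mult_le_cancel_right_pos) simp
        next
          case 2
          hence "- 1 * z $ j \<le> (y v* A) $ j * z $ j"
            using z(1)[OF True] by simp
          thus ?thesis
            using 2 cD(2)[of j] by (simp only: mult_le_cancel_right_neg) simp
        qed
      qed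
      note tight = this
      from eventually_at_right_less show ?thesis
        by eventually_elim (use tight in \<open>auto simp: True sgn_mult\<close>)
    qed
  qed
  from ev1 ev2 have "\<forall>\<^sub>F \<epsilon> in at_right 0. certifies A b (d - \<epsilon>) (x - \<epsilon> *\<^sub>R z) y"
  proof eventually_elim
    case (elim \<epsilon>)
    moreover have "(A *v (x - \<epsilon> *\<^sub>R z) - b) $ i = (d - \<epsilon>) * sgn (y $ i)" if "y $ i \<noteq> 0" for i
      unfolding residual using cD(4)[OF that] z(2)[OF that] by (simp add: algebra_simps)
    ultimately show ?case
      using cD(2) unfolding certifies_def by blast
  qed
  thus ?thesis
    by blast
qed

section \<open>Solvability of the linear programs\<close>

text \<open>Complementary slackness by cases on the support is not visibly a closed condition; rewritten
  with absolute values it consists of equations between continuous functions.\<close>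

lemma certifies_iff_continuous:
  "certifies A b d x y \<longleftrightarrow>
     (\<forall>i. \<bar>(A *v x - b) $ i\<bar> \<le> d) \<and>
     (\<forall>j. \<bar>(y v* A) $ j\<bar> \<le> 1) \<and>
     (\<forall>j. (y v* A) $ j * x $ j = - \<bar>x $ j\<bar>) \<and>
     (\<forall>i. (A *v x - b) $ i * y $ i = d * \<bar>y $ i\<bar>)"
proof -
  have col: "(a * u = - \<bar>u\<bar>) \<longleftrightarrow> (u \<noteq> 0 \<longrightarrow> a = - sgn u)" for a u :: real
    using mult_cancel_right[of a u "- sgn u"] by (auto simp: abs_sgn mult.commute)
  have row: "(a * u = d * \<bar>u\<bar>) \<longleftrightarrow> (u \<noteq> 0 \<longrightarrow> a = d * sgn u)" for a u :: real
    using mult_cancel_right[of a u "d * sgn u"] by (auto simp: abs_sgn mult_ac)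
  show ?thesis
    unfolding certifies_def col row ..
qed

lemma closed_certifies:
  assumes "continuous_on UNIV d" "continuous_on UNIV x" "continuous_on UNIV y"
  shows "closed {p. certifies A b (d p) (x p) (y p)}"
proof -
  note mult = bounded_linear.continuous_on[OF matrix_vector_mul_bounded_linear]
  have cont: "continuous_on UNIV (\<lambda>p. (A *v x p - b) $ i)"
      "continuous_on UNIV (\<lambda>p. (transpose A *v y p) $ j)"
      "continuous_on UNIV (\<lambda>p. x p $ j)" "continuous_on UNIV (\<lambda>p. y p $ i)" for i j
    by (intro continuous_on_component continuous_on_diff continuous_on_const mult assms)+
  note cont = cont[unfolded transpose_matrix_vector]
  have "closed {p. \<forall>i. \<bar>(A *v x p - b) $ i\<bar> \<le> d p}"
    by (intro closed_Collect_all closed_Collect_le continuous_on_rabs cont assms(1))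
  moreover have "closed {p. \<forall>j. \<bar>(y p v* A) $ j\<bar> \<le> 1}"
    by (intro closed_Collect_all closed_Collect_le continuous_on_rabs continuous_on_const cont)
  moreover have "closed {p. \<forall>j. (y p v* A) $ j * x p $ j = - \<bar>x p $ j\<bar>}"
    by (intro closed_Collect_all closed_Collect_eq continuous_on_mult continuous_on_minus
        continuous_on_rabs cont)
  moreover have "closed {p. \<forall>i. (A *v x p - b) $ i * y p $ i = d p * \<bar>y p $ i\<bar>}"
    by (intro closed_Collect_all closed_Collect_eq continuous_on_mult
        continuous_on_rabs cont assms(1))
  ultimately show ?thesis
    unfolding certifies_iff_continuous by (intro closed_Collect_conj)
qed

lemma largest_certificate_exists:
  assumes cert: "certifies A b d x y0"
    and feas: "P_feasible A b \<delta> x0" and "\<delta> < d"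
  shows "\<exists>y. certifies A b d x y \<and> (\<forall>y'. certifies A b d x y' \<longrightarrow> l1_norm y' \<le> l1_norm y)"
proof -
  let ?C = "{y. certifies A b d x y}"
  have "norm y \<le> (l1_norm x0 - l1_norm x) / (d - \<delta>)" if "y \<in> ?C" for y
  proof -
    have "l1_norm x + (d - \<delta>) * l1_norm y \<le> l1_norm x0"
      using that feas by (intro certifies_gap) (auto simp: P_feasible_iff)
    hence "l1_norm y \<le> (l1_norm x0 - l1_norm x) / (d - \<delta>)"
      using \<open>\<delta> < d\<close> by (simp add: field_simps)
    thus ?thesis
      using norm_le_l1_norm[of y] by simp
  qed
  hence "bounded ?C"
    unfolding bounded_iff by blast
  moreover have "closed ?C"
    by (intro closed_certifies continuous_intros)
  ultimately have "compact ?C"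
    by (simp add: compact_eq_bounded_closed)
  moreover have "?C \<noteq> {}"
    using cert by blast
  moreover have "continuous_on ?C l1_norm"
    unfolding l1_norm_def by (intro continuous_intros)
  ultimately obtain y where "y \<in> ?C" "\<forall>y'\<in>?C. l1_norm y' \<le> l1_norm y"
    using continuous_attains_sup by metis
  thus ?thesis
    by blast
qed

lemma smallest_level_exists:
  assumes cert: "certifies A b d x0 y" and "0 \<le> \<delta>" "\<delta> \<le> d"
  shows "\<exists>x e. \<delta> \<le> e \<and> certifies A b e x y \<and>
           (\<forall>x' e'. \<delta> \<le> e' \<longrightarrow> certifies A b e' x' y \<longrightarrow> e \<le> e')"
proof -
  let ?C = "{p. certifies A b (snd p) (fst p) y} \<inter> {p. \<delta> \<le> snd p \<and> snd p \<le> d}"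
  have "?C \<subseteq> cball 0 (- (y \<bullet> b)) \<times> {\<delta>..d}"
  proof
    fix p assume "p \<in> ?C"
    hence p: "certifies A b (snd p) (fst p) y" "\<delta> \<le> snd p" "snd p \<le> d"
      by auto
    have "norm (fst p) \<le> - snd p * l1_norm y - y \<bullet> b"
      using norm_le_l1_norm[of "fst p"] certifies_l1_norm[OF p(1)] by simp
    moreover have "0 \<le> snd p * l1_norm y"
      using l1_norm_nonneg[of y] p(2) \<open>0 \<le> \<delta>\<close> by simp
    ultimately show "p \<in> cball 0 (- (y \<bullet> b)) \<times> {\<delta>..d}"
      using p by (simp add: mem_Times_iff)
  qed
  hence "bounded ?C"
    by (rule bounded_subset[rotated]) (intro bounded_Times bounded_cball bounded_closed_interval)
  moreover have "closed ?C"
    by (intro closed_Int closed_certifies closed_Collect_conj closed_Collect_le continuous_intros)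
  ultimately have "compact ?C"
    by (simp add: compact_eq_bounded_closed)
  moreover have "?C \<noteq> {}"
    using assms by (intro ex_in_conv[THEN iffD1] exI[of _ "(x0, d)"]) simp
  moreover have "continuous_on ?C snd"
    by (intro continuous_intros)
  ultimately obtain p where p: "p \<in> ?C" "\<And>q. q \<in> ?C \<Longrightarrow> snd p \<le> snd q"
    using continuous_attains_inf[of ?C snd] by blast
  have "snd p \<le> e'" if "\<delta> \<le> e'" "certifies A b e' x' y" for x' e'
    using p(1) p(2)[of "(x', e')"] that by (cases "e' \<le> d") auto
  thus ?thesis
    using p(1) by (intro exI[of _ "fst p"] exI[of _ "snd p"]) auto
qed

section \<open>Runs of the algorithm\<close>

definition certified_state ::
  "real ^ 'n ^ 'm \<Rightarrow> real ^ 'm \<Rightarrow> real \<Rightarrow> ('m, 'n) houdini_state \<Rightarrow> bool" where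
  "certified_state A b \<delta> = (\<lambda>(x, d, IP, JP).
     \<delta> \<le> d \<and> IP = {i. \<bar>(A *v x - b) $ i\<bar> = d} \<and> JP = {j. x $ j \<noteq> 0} \<and>
     (\<exists>y. certifies A b d x y))"

lemma dual_solution_iff:
  assumes "certified_state A b \<delta> (x, d, IP, JP)" "0 < d"
  shows "dual_solution A b (x, d, IP, JP) y \<longleftrightarrow>
           certifies A b d x y \<and> (\<forall>y'. certifies A b d x y' \<longrightarrow> l1_norm y' \<le> l1_norm y)"
proof -
  have "\<bar>(A *v x - b) $ i\<bar> \<le> d" for i
    using assms(1) unfolding certified_state_def by (auto dest: certifiesD(1))
  from dual_feasible_iff[OF assms(2) this]
  have feas: "dual_feasible A b (x, d, IP, JP) = certifies A b d x"
    using assms(1) unfolding certified_state_def by auto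
  have "vsign (A *v x - b) \<bullet> y = l1_norm y" if "certifies A b d x y" for y
    by (rule l1_norm_certificate[OF that assms(2)])
  thus ?thesis
    unfolding dual_solution_def is_arg_min_def prod.case feas by (auto simp: not_less)
qed

lemma primal_solution_iff:
  assumes "0 \<le> \<delta>" "\<And>j. \<bar>(y v* A) $ j\<bar> \<le> 1"
  shows "primal_solution A b \<delta> d y (x, t) \<longleftrightarrow>
           \<delta> \<le> d - t \<and> certifies A b (d - t) x y \<and>
           (\<forall>x' e. \<delta> \<le> e \<longrightarrow> certifies A b e x' y \<longrightarrow> d - t \<le> e)"
proof -
  have reparam: "(\<forall>t'. P (d - t') \<longrightarrow> t' \<le> t) \<longleftrightarrow> (\<forall>e. P e \<longrightarrow> d - t \<le> e)" for P :: "real \<Rightarrow> bool"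
  proof safe
    show "d - t \<le> e" if "\<forall>t'. P (d - t') \<longrightarrow> t' \<le> t" "P e" for e
      using that(1)[rule_format, of "d - e"] that(2) by simp
    show "t' \<le> t" if "\<forall>e. P e \<longrightarrow> d - t \<le> e" "P (d - t')" for t'
      using that(1)[rule_format, OF that(2)] by simp
  qed
  have "primal_solution A b \<delta> d y (x, t) \<longleftrightarrow> \<delta> \<le> d - t \<and> certifies A b (d - t) x y \<and>
          (\<forall>x' t'. \<delta> \<le> d - t' \<and> certifies A b (d - t') x' y \<longrightarrow> t' \<le> t)"
    unfolding primal_solution_def is_arg_max_def
    by (auto simp: primal_feasible_iff[OF assms] not_less)
  thus ?thesis
    using reparam[of "\<lambda>e. \<exists>x'. \<delta> \<le> e \<and> certifies A b e x' y"] by blast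
qed

text \<open>Besides preserving the invariant, a step lowers the level and makes it the smallest one
  that some \<open>y\<close> can certify. The last fact determines the new level by \<open>y\<close> alone, whatever solution
  of the primal program was picked; this is what the termination proof rests on.\<close>

lemma houdini_step_certified:
  assumes "0 \<le> \<delta>" and inv: "certified_state A b \<delta> (x, d, IP, JP)"
    and step: "houdini_step A b \<delta> (x, d, IP, JP) (x', d', IP', JP')"
  shows "certified_state A b \<delta> (x', d', IP', JP') \<and> d' < d \<and>
    (\<exists>y. certifies A b d' x' y \<and> (\<forall>x'' e. \<delta> \<le> e \<longrightarrow> certifies A b e x'' y \<longrightarrow> d' \<le> e))"
  using step
proof cases
  case (1 y t')
  have "\<delta> < d"
    using \<open>d \<noteq> \<delta>\<close> inv unfolding certified_state_def by simp
  hence "0 < d"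
    using \<open>0 \<le> \<delta>\<close> by simp
  have y: "certifies A b d x y" "\<And>y'. certifies A b d x y' \<Longrightarrow> l1_norm y' \<le> l1_norm y"
    using 1 dual_solution_iff[OF inv \<open>0 < d\<close>] by blast+
  have x': "\<delta> \<le> d'" "certifies A b d' x' y"
      "\<And>x'' e. \<delta> \<le> e \<Longrightarrow> certifies A b e x'' y \<Longrightarrow> d' \<le> e"
    using 1 primal_solution_iff[OF \<open>0 \<le> \<delta>\<close> certifiesD(2)[OF y(1)]] by blast+
  obtain z where "\<forall>\<^sub>F \<epsilon> in at_right 0. certifies A b (d - \<epsilon>) (x - \<epsilon> *\<^sub>R z) y"
    using largest_certificate_descends[OF y(1) \<open>0 < d\<close> y(2)] by blast
  moreover have "\<forall>\<^sub>F \<epsilon> in at_right 0. 0 < \<epsilon> \<and> \<epsilon> < d - \<delta>"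
    using \<open>\<delta> < d\<close> eventually_at_right_real[of 0 "d - \<delta>"] by simp
  ultimately have "\<forall>\<^sub>F \<epsilon> in at_right 0. certifies A b (d - \<epsilon>) (x - \<epsilon> *\<^sub>R z) y \<and> 0 < \<epsilon> \<and> \<epsilon> < d - \<delta>"
    by (rule eventually_conj)
  from eventually_happens[OF this] obtain \<epsilon> where
    "certifies A b (d - \<epsilon>) (x - \<epsilon> *\<^sub>R z) y" "0 < \<epsilon>" "\<epsilon> < d - \<delta>"
    by auto
  hence "d' < d"
    using x'(3)[of "d - \<epsilon>"] by force
  thus ?thesis
    using x' 1 unfolding certified_state_def by auto
qed

lemma certified_state_init:
  assumes "\<delta> < infnorm b"
  shows "certified_state A b \<delta> (houdini_init b)"
proof -
  have "certifies A b (infnorm b) 0 0"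
    unfolding certifies_def by (simp add: component_le_infnorm_cart)
  thus ?thesis
    using assms unfolding certified_state_def houdini_init_def by auto
qed

lemma certified_state_reachable:
  assumes "0 \<le> \<delta>" "\<delta> < infnorm b" and "houdini_reachable A b \<delta> s"
  shows "certified_state A b \<delta> s"
  using assms(3) unfolding houdini_reachable_def
proof induction
  case base
  show ?case
    by (rule certified_state_init[OF assms(2)])
next
  case (step s t)
  thus ?case
    using houdini_step_certified[OF assms(1)] by (cases s; cases t) blast
qed

text \<open>Two steps whose dual solutions have the same pattern would end at the same level, but levels
  strictly decrease; and there are only finitely many patterns.\<close>

lemma houdini_terminates:
  fixes A :: "real ^ 'n ^ 'm" and s :: "nat \<Rightarrow> ('m, 'n) houdini_state"
  assumes "0 \<le> \<delta>" "\<delta> < infnorm b" and init: "s 0 = houdini_init b"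
    and step: "\<And>k. houdini_step A b \<delta> (s k) (s (Suc k))"
  shows False
proof -
  have inv: "certified_state A b \<delta> (s k)" for k
  proof (rule certified_state_reachable[OF assms(1,2)])
    show "houdini_reachable A b \<delta> (s k)"
      unfolding houdini_reachable_def
      by (induction k) (auto simp: init intro: rtranclp.rtrancl_into_rtrancl step)
  qed
  let ?x = "\<lambda>k. fst (s k)" and ?d = "\<lambda>k. fst (snd (s k))"
  have run: "?d (Suc k) < ?d k \<and> (\<exists>y. certifies A b (?d (Suc k)) (?x (Suc k)) y \<and>
      (\<forall>x e. \<delta> \<le> e \<longrightarrow> certifies A b e x y \<longrightarrow> ?d (Suc k) \<le> e))" for k
  proof -
    obtain x d IP JP where "s k = (x, d, IP, JP)"
      by (cases "s k")
    moreover obtain x' d' IP' JP' where "s (Suc k) = (x', d', IP', JP')"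
      by (cases "s (Suc k)")
    ultimately have eqs: "s k = (x, d, IP, JP)" "s (Suc k) = (x', d', IP', JP')"
      by blast+
    show ?thesis
      using houdini_step_certified[OF assms(1) inv[of k, unfolded eqs] step[of k, unfolded eqs]]
      unfolding eqs by simp
  qed
  then obtain y where y: "\<And>k. certifies A b (?d (Suc k)) (?x (Suc k)) (y k)"
      "\<And>k x e. \<delta> \<le> e \<Longrightarrow> certifies A b e x (y k) \<Longrightarrow> ?d (Suc k) \<le> e"
    by metis
  define pattern where "pattern k =
    ({i. 0 < y k $ i}, {i. y k $ i < 0}, {j. (y k v* A) $ j = 1}, {j. (y k v* A) $ j = - 1})" for k
  have level_le: "?d (Suc k) \<le> ?d (Suc l)" if same: "pattern k = pattern l" for k l
  proof -
    have signs: "0 < y k $ i \<longleftrightarrow> 0 < y l $ i" "y k $ i < 0 \<longleftrightarrow> y l $ i < 0" for i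
      using same unfolding pattern_def by auto
    have "sgn (y k $ i) = sgn (y l $ i)" for i
      using signs[of i] by (cases "y k $ i" "0 :: real" rule: linorder_cases) auto
    moreover have "(y k v* A) $ j = 1 \<longleftrightarrow> (y l v* A) $ j = 1"
        "(y k v* A) $ j = - 1 \<longleftrightarrow> (y l v* A) $ j = - 1" for j
      using same unfolding pattern_def by auto
    ultimately have "certifies A b (?d (Suc l)) (?x (Suc l)) (y k)"
      using certifies_pattern[OF y(1)] certifiesD(2)[OF y(1)] by blast
    moreover have "\<delta> \<le> ?d (Suc l)"
      using inv[of "Suc l"] unfolding certified_state_def by (auto split: prod.splits)
    ultimately show ?thesis
      using y(2) by blast
  qed
  have "\<not> inj pattern"
    using infinite_UNIV_nat finite_imageD[OF finite_subset[OF subset_UNIV finite]] by blast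
  then obtain k l where "k < l" "pattern k = pattern l"
    unfolding inj_def by (metis linorder_neqE_nat)
  moreover have "?d (Suc l) < ?d (Suc k)"
    using \<open>k < l\<close> lift_Suc_mono_less[of "\<lambda>k. - ?d k" "Suc k" "Suc l"] run by simp
  ultimately show False
    using level_le[of k l] by simp
qed

theorem theorem2p4:
  fixes A :: "real ^ 'n ^ 'm" and b :: "real ^ 'm" and \<delta> :: real
  assumes "0 \<le> \<delta>" and "\<delta> < infnorm b"
  shows
    \<comment> \<open>no choice of solutions of the linear programs makes the loop run forever\<close>
    "(\<nexists>s :: nat \<Rightarrow> ('m, 'n) houdini_state.
        s 0 = houdini_init b \<and> (\<forall>k. houdini_step A b \<delta> (s k) (s (Suc k)))) \<and>
    \<comment> \<open>if the problem has a feasible point, every linear program to be solved has a solution,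
       so that the loop can only end through its stopping criterion\<close>
     ((\<exists>x. P_feasible A b \<delta> x) \<longrightarrow>
        (\<forall>x d IP JP. houdini_reachable A b \<delta> (x, d, IP, JP) \<and> d \<noteq> \<delta> \<longrightarrow>
           (\<exists>y. dual_solution A b (x, d, IP, JP) y) \<and>
           (\<forall>y. dual_solution A b (x, d, IP, JP) y \<longrightarrow>
              (\<exists>x' t'. primal_solution A b \<delta> d y (x', t'))))) \<and>
    \<comment> \<open>the returned point is optimal\<close>
     (\<forall>x d IP JP. houdini_reachable A b \<delta> (x, d, IP, JP) \<and> d = \<delta> \<longrightarrow> P_optimal A b \<delta> x)"
proof (intro conjI impI allI notI; (elim exE conjE)?)
  show False if "s 0 = houdini_init b" "\<forall>k. houdini_step A b \<delta> (s k) (s (Suc k))"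
    for s :: "nat \<Rightarrow> ('m, 'n) houdini_state"
    by (rule houdini_terminates[of \<delta> b s A]) (use assms that in auto)
next
  fix x0 x d IP JP
  assume feas: "P_feasible A b \<delta> x0" and "houdini_reachable A b \<delta> (x, d, IP, JP)" and "d \<noteq> \<delta>"
  hence inv: "certified_state A b \<delta> (x, d, IP, JP)"
    using certified_state_reachable[OF assms] by blast
  hence "\<delta> < d" and cert: "\<exists>y. certifies A b d x y"
    using \<open>d \<noteq> \<delta>\<close> unfolding certified_state_def by auto
  hence "0 < d"
    using assms(1) by simp
  show "\<exists>y. dual_solution A b (x, d, IP, JP) y"
    unfolding dual_solution_iff[OF inv \<open>0 < d\<close>]
    using cert largest_certificate_exists[OF _ feas \<open>\<delta> < d\<close>] by blast
  fix y
  assume "dual_solution A b (x, d, IP, JP) y"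
  hence y: "certifies A b d x y"
    using dual_solution_iff[OF inv \<open>0 < d\<close>] by blast
  from smallest_level_exists[OF this assms(1) less_imp_le[OF \<open>\<delta> < d\<close>]]
  obtain x' e where "\<delta> \<le> e" "certifies A b e x' y"
      "\<forall>x'' e'. \<delta> \<le> e' \<longrightarrow> certifies A b e' x'' y \<longrightarrow> e \<le> e'"
    by blast
  hence "primal_solution A b \<delta> d y (x', d - e)"
    unfolding primal_solution_iff[OF assms(1) certifiesD(2)[OF y]] by simp
  thus "\<exists>x' t'. primal_solution A b \<delta> d y (x', t')"
    by blast
next
  fix x d IP JP
  assume "houdini_reachable A b \<delta> (x, d, IP, JP)" "d = \<delta>"
  thus "P_optimal A b \<delta> x"
    using certified_state_reachable[OF assms] certifies_imp_P_optimal
    unfolding certified_state_def by fastforce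
qed

end
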